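(* Fix a task $x$ and a harness $h$ with sub-goal sequence $\Delta_h(x)=(g_1,\dots,g_T)$, $T=T_h(x)$, and goal-consistent execution law $P_h(\cdot\mid x)$; let $K_t$, $B_t$, $B_{<t}$, $\mathrm{Succ}_x(\tau_h)$ be as in the context. Suppose there is a real-valued latent progress coordinate $\phi_x$ (defined on sub-goals and on completed prefixes), and put $$\ell_t(K_{t-1}):=\phi_x(g_t)-\phi_x(K_{t-1}).$$ At stage $t$ the agent may make at most $M_t\ge 1$ primitive attempts; for $m=1,\dots,M_t$ let the real random variable $Z_{t,m}$ denote the cumulative latent progress made after $m$ primitive attempts within stage $t$, measured from $K_{t-1}$. Assume that for every $t=1,\dots,T$ and almost surely over completed prefixes $K_{t-1}$ satisfying $B_{<t}$: (i) (Finite-attempt recoverability tube) there is $\varepsilon_t(K_{t-1})\ge 0$ such that $$B_t\subseteq\bigcup_{m=1}^{M_t}\left\{|Z_{t,m}-\ell_t(K_{t-1})|\le\varepsilon_t(K_{t-1})\right\};$$ (ii) (Cumulative controllability windows) for each $m=1,\dots,M_t$ there are $\mu_{t,m}^-(K_{t-1})\le\mu_{t,m}^+(K_{t-1})$, $\sigma_{t,m}(K_{t-1})>0$ and $\mu_{t,m}(K_{t-1})\in[\mu_{t,m}^-(K_{t-1}),\mu_{t,m}^+(K_{t-1})]$ such that for all $u\ge 0$ both $$P_h\left(Z_{t,m}-\mu_{t,m}(K_{t-1})\ge u\mid K_{t-1}\right)\le\exp\left(-\frac{u^2}{2\sigma_{t,m}^2(K_{t-1})}\right),$$ $$P_h\left(\mu_{t,m}(K_{t-1})-Z_{t,m}\ge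 u\mid K_{t-1}\right)\le\exp\left(-\frac{u^2}{2\sigma_{t,m}^2(K_{t-1})}\right);$$ (iii) (Boundary loss) there is $\eta_t(K_{t-1})\ge 0$ such that $$P_h(B_t\mid K_{t-1})\le e^{-\eta_t(K_{t-1})}\,P_h\left(\bigcup_{m=1}^{M_t}\left\{|Z_{t,m}-\ell_t(K_{t-1})|\le\varepsilon_t(K_{t-1})\right\}\,\Big|\,K_{t-1}\right).$$ Define $$a_{t,m}(K_{t-1}):=\frac{\left(d\left(\ell_t(K_{t-1}),[\mu_{t,m}^-(K_{t-1}),\mu_{t,m}^+(K_{t-1})]\right)-\varepsilon_t(K_{t-1})\right)_+^2}{2\sigma_{t,m}^2(K_{t-1})},\qquad \rho_t^{(M)}(K_{t-1}):=\min_{1\le m\le M_t}a_{t,m}(K_{t-1}),$$ let $\mathcal R_{t-1}(h,x):=\operatorname{supp}_{P_h(\cdot\mid B_{<t},x)}(K_{t-1})$ be the support of the law of $K_{t-1}$ under $P_h(\cdot\mid B_{<t},x)$, and let $$\gamma_t^{(M)}(h;x):=\inf_{K_{t-1}\in\mathcal R_{t-1}(h,x)}\left\{\eta_t(K_{t-1})+\left(\rho_t^{(M)}(K_{t-1})-\log M_t\right)_+\right\}.$$ Then $$-\log P_h(\mathrm{Succ}_x(\tau_h)\mid x)\ \ge\ \sum_{t=1}^{T_h(x)}\gamma_t^{(M)}(h;x),$$ equivalently $$P_h(\mathrm{Succ}_x(\tau_h)\mid x)\le\exp\left(-\sum_{t=1}^{T_h(x)}\gamma_t^{(M)}(h;x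)\right).$$
   Context: Setting. A task $x$ has a unique correct final answer $y^\star(x)$. A harness $h$ assigns to $x$ a finite ordered list of sub-goals $(g_1,\dots,g_T)$ with $T=T_h(x)$ (determined by $x$ and $h$). A harness-conditioned execution is $\tau_h=(g_1,\tau_1,\dots,g_T,\tau_T)$, where $\tau_t$ is the random trajectory (finite sequence of states and actions) produced by the agent while pursuing $g_t$; $P_h(\cdot\mid x)$ denotes its law. The execution produces a final answer $y(\tau_h)$, and $\mathrm{Succ}_x(\tau_h):=\{y(\tau_h)=y^\star(x)\}$. Prefixes. The completed prefix after stage $t$ is $K_t:=(x,g_1,\tau_1,\dots,g_t,\tau_t)$, $K_0:=x$. A prefix $K_t$ with $t<T$ is recoverable if there exist $\tau_{t+1},\dots,\tau_T$ for which the resulting full execution is successful; $K_T$ is recoverable iff the execution is successful. $B_t$ is the event that $K_t$ is recoverable; $B_{<t}:=\bigcap_{s<t}B_s$ and $B_{<1}$ is the whole sample space. In particular $B_{<t}$ is determined by $K_{t-1}$. Goal consistency (standing assumption): $\mathrm{Succ}_x(\tau_h)=\bigcap_{t=1}^{T}B_t$ as events. Notation and conventions: $d(a,I)=\inf_{b\in I}|a-b|$; $(u)_+=\max\{u,0\}$; $-\log 0=+\infty$. Prefixes take values in a Polish space, all the sets and functions mentioned are measurable, and $P_h(\cdot\mid K_{t-1})$ denotes a regular conditional probability given $K_{t-1}$. If $P_h(B_{<t}\mid x)=0$, the support $\mathcal R_{t-1}(h,x)$ is taken to be empty and the infimum over it is $+\infty$. *)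

theory Defs
  imports "HOL-Probability.Probability"
begin

type_synonym ('s, 'a) trajectory = "('s + 'a) list"

type_synonym ('g, 's, 'a) execution = "('g \<times> ('s, 'a) trajectory) list"

type_synonym ('x, 'g, 's, 'a) stage_prefix = "'x \<times> ('g, 's, 'a) execution"

(* A harness is represented by the map sending a task to its list of sub-goals
   (g_1, ..., g_T); stages are counted from 1, list positions from 0. *)

definition num_stages :: "('x \<Rightarrow> 'g list) \<Rightarrow> 'x \<Rightarrow> nat" where
  "num_stages h x = length (h x)"

definition sub_goal :: "('x \<Rightarrow> 'g list) \<Rightarrow> 'x \<Rightarrow> nat \<Rightarrow> 'g" where
  "sub_goal h x t = h x ! (t - 1)"

(* (g_1, \<tau>_1, ..., g_t, \<tau>_t) at the sample point w; for t = T this is the execution. *)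
definition stages_upto ::
  "('x \<Rightarrow> 'g list) \<Rightarrow> 'x \<Rightarrow> (nat \<Rightarrow> 'w \<Rightarrow> ('s, 'a) trajectory) \<Rightarrow> nat \<Rightarrow> 'w \<Rightarrow> ('g, 's, 'a) execution" where
  "stages_upto h x tau t w = map (\<lambda>s. (sub_goal h x s, tau s w)) [1..<Suc t]"

definition completed_prefix ::
  "('x \<Rightarrow> 'g list) \<Rightarrow> 'x \<Rightarrow> (nat \<Rightarrow> 'w \<Rightarrow> ('s, 'a) trajectory) \<Rightarrow> nat \<Rightarrow> 'w \<Rightarrow> ('x, 'g, 's, 'a) stage_prefix" where
  "completed_prefix h x tau t w = (x, stages_upto h x tau t w)"

(* "answer" reads off the final answer of an execution, "ystar" is the correct answer of a task.
   For a complete prefix the list of missing trajectories is empty,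
   so that recoverability is success; see recoverable_complete. *)
definition recoverable ::
  "('x \<Rightarrow> 'g list) \<Rightarrow> (('g, 's, 'a) execution \<Rightarrow> 'y) \<Rightarrow> ('x \<Rightarrow> 'y) \<Rightarrow> ('x, 'g, 's, 'a) stage_prefix \<Rightarrow> bool" where
  "recoverable h answer ystar k \<longleftrightarrow>
     (case k of (x, es) \<Rightarrow>
        \<exists>ts. length es + length ts = num_stages h x \<and>
             answer (es @ zip (drop (length es) (h x)) ts) = ystar x)"

lemma recoverable_complete:
  "length es = num_stages h x \<Longrightarrow> recoverable h answer ystar (x, es) \<longleftrightarrow> answer es = ystar x"
  by (simp add: recoverable_def)

definition Polish_topology :: "'k topology \<Rightarrow> bool" where
  "Polish_topology X \<longleftrightarrow> completely_metrizable_space X \<and> second_countable X"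

definition borel_of_topology :: "'k topology \<Rightarrow> 'k measure" where
  "borel_of_topology X = sigma (topspace X) {U. openin X U}"

lemma space_borel_of_topology: "space (borel_of_topology X) = topspace X"
  and sets_borel_of_topology: "sets (borel_of_topology X) = sigma_sets (topspace X) {U. openin X U}"
  unfolding borel_of_topology_def
  by (auto intro!: space_measure_of sets_measure_of dest: openin_subset)

definition topological_support :: "'k topology \<Rightarrow> 'k measure \<Rightarrow> 'k set" where
  "topological_support X N =
     {k \<in> topspace X. \<forall>U. openin X U \<and> k \<in> U \<longrightarrow> emeasure N U > 0}"

(* The support of the law of Y under P( . | A); empty by convention if A is a null event. *)
definition conditional_support :: "'k topology \<Rightarrow> 'w measure \<Rightarrow> 'w set \<Rightarrow> ('w \<Rightarrow> 'k) \<Rightarrow> 'k set" where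
  "conditional_support X P A Y =
     (if measure P A = 0 then {}
      else topological_support X (distr (uniform_measure P A) (borel_of_topology X) Y))"

(* kappa k is P( . | Y = k): a probability kernel from S to the sample space
   that disintegrates P along Y. *)
definition regular_conditional_probability ::
  "'w measure \<Rightarrow> 'k measure \<Rightarrow> ('w \<Rightarrow> 'k) \<Rightarrow> ('k \<Rightarrow> 'w measure) \<Rightarrow> bool" where
  "regular_conditional_probability P S Y kappa \<longleftrightarrow>
     kappa \<in> S \<rightarrow>\<^sub>M prob_algebra P \<and>
     (\<forall>A \<in> sets P. \<forall>C \<in> sets S.
        emeasure P (A \<inter> (Y -` C \<inter> space P)) = (\<integral>\<^sup>+k\<in>C. emeasure (kappa k) A \<partial>distr P S Y))"

definition neg_log :: "real \<Rightarrow> ereal" where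
  "neg_log p = (if p = 0 then \<infinity> else ereal (- ln p))"

definition exp_ereal :: "ereal \<Rightarrow> ereal" where
  "exp_ereal e = (case e of ereal r \<Rightarrow> ereal (exp r) | PInfty \<Rightarrow> \<infinity> | MInfty \<Rightarrow> 0)"

end

(* Given K (t - 1) in Blt t, reaching the tube at attempt m forces a deviation of
   Z t m from its centre by d(ell t, window) - eps t, always on the same side, so a single
   sub-Gaussian tail gives exp (- a t m) without a factor 2.  The union bound over the M t
   attempts and the boundary loss bound P(B t | K (t - 1)) by
   exp (- (eta t + (rho t - ln (M t))_+)), hence by exp (- gamma t), because K (t - 1) lies
   almost surely in its support.  Integrating over Blt t gives
   P(Blt (t + 1)) <= exp (- gamma t) P(Blt t), and these ratios telescope. *)
theory Submission
  imports Defs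
begin

section \<open>Supports of laws on second countable spaces\<close>

text \<open>A point outside the support has a null open neighbourhood, hence lies in a null member
  of a countable base. The union of the null base sets is null, so almost every point avoids all of
  them.\<close>

lemma AE_topological_support:
  assumes X: "second_countable X" and N: "sets N = sets (borel_of_topology X)"
  shows "AE k in N. k \<in> topological_support X N"
proof -
  obtain \<B> where \<B>: "countable \<B>" "\<And>V. V \<in> \<B> \<Longrightarrow> openin X V"
    and base: "\<And>U k. openin X U \<Longrightarrow> k \<in> U \<Longrightarrow> \<exists>V\<in>\<B>. k \<in> V \<and> V \<subseteq> U"
    using X unfolding second_countable_def by metis
  have sets_open: "U \<in> sets N" if "openin X U" for U
    using that by (auto simp: N sets_borel_of_topology)
  have space: "space N = topspace X"
    using sets_eq_imp_space_eq[OF N] by (simp add: space_borel_of_topology)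
  have "AE k in N. \<forall>V\<in>{V\<in>\<B>. emeasure N V = 0}. k \<notin> V"
  proof (subst AE_ball_countable)
    show "countable {V \<in> \<B>. emeasure N V = 0}" using \<B>(1) by auto
    show "\<forall>V\<in>{V \<in> \<B>. emeasure N V = 0}. AE k in N. k \<notin> V"
      using \<B>(2) sets_open by (auto intro!: AE_not_in simp: null_sets_def)
  qed
  then show ?thesis
  proof (rule AE_mp, intro AE_I2 impI)
    fix k assume k: "k \<in> space N" and null: "\<forall>V\<in>{V\<in>\<B>. emeasure N V = 0}. k \<notin> V"
    have "emeasure N U > 0" if U: "openin X U" "k \<in> U" for U
    proof -
      obtain V where V: "V \<in> \<B>" "k \<in> V" "V \<subseteq> U" using base[OF U] by auto
      then have "0 < emeasure N V" using null by (auto simp: zero_less_iff_neq_zero)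
      also have "\<dots> \<le> emeasure N U" by (rule emeasure_mono[OF V(3) sets_open[OF U(1)]])
      finally show ?thesis .
    qed
    then show "k \<in> topological_support X N"
      using k by (auto simp: topological_support_def space)
  qed
qed

text \<open>This turns an infimum over the support into a bound at almost every sample point of
  \<open>A\<close>. For a null \<open>A\<close> the support is empty by convention, but then almost
  no \<open>w\<close> lies in \<open>A\<close>.\<close>

lemma AE_conditional_support:
  assumes P: "prob_space P" and X: "second_countable X"
    and Y: "Y \<in> P \<rightarrow>\<^sub>M borel_of_topology X" and A: "A \<in> sets P"
  shows "AE w in P. w \<in> A \<longrightarrow> Y w \<in> conditional_support X P A Y"
proof (cases "measure P A = 0")
  interpret prob_space P by fact
  case True
  then have "A \<in> null_sets P" using A by (auto simp: emeasure_eq_measure)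
  then show ?thesis using AE_not_in by fastforce
next
  interpret prob_space P by fact
  case False
  then have pos: "emeasure P A \<noteq> 0" "emeasure P A < \<infinity>" by (auto simp: emeasure_eq_measure)
  have Y': "Y \<in> uniform_measure P A \<rightarrow>\<^sub>M borel_of_topology X"
    using Y by (simp cong: measurable_cong_sets)
  have "AE k in distr (uniform_measure P A) (borel_of_topology X) Y. k \<in> conditional_support X P A Y"
    using False AE_topological_support[OF X, of "distr (uniform_measure P A) (borel_of_topology X) Y"]
    by (simp add: conditional_support_def)
  then have "AE w in uniform_measure P A. Y w \<in> conditional_support X P A Y"
    by (rule AE_distrD[OF Y'])
  then show ?thesis
    by (simp only: AE_uniform_measure[OF pos])
qed

section \<open>Sub-Gaussian tails and the union bound over attempts\<close>

text \<open>The target \<open>l\<close> is at least as far from \<open>mu\<close> as from the window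
  containing \<open>mu\<close>. The side of \<open>mu\<close> on which \<open>l\<close> lies decides
  which tail applies; the exact position of \<open>mu\<close> in the window does not enter the
  bound.\<close>

lemma tube_tail_bound:
  fixes Z :: "'w \<Rightarrow> real"
  assumes Q: "prob_space Q" and Z: "Z \<in> borel_measurable Q"
    and mu: "mu \<in> {lo..hi}"
    and up: "\<And>u. u \<ge> 0 \<Longrightarrow> measure Q {w \<in> space Q. Z w - mu \<ge> u} \<le> exp (- (u\<^sup>2 / (2 * s\<^sup>2)))"
    and down: "\<And>u. u \<ge> 0 \<Longrightarrow> measure Q {w \<in> space Q. mu - Z w \<ge> u} \<le> exp (- (u\<^sup>2 / (2 * s\<^sup>2)))"
  shows "measure Q {w \<in> space Q. \<bar>Z w - l\<bar> \<le> e}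
           \<le> exp (- ((max 0 (infdist l {lo..hi} - e))\<^sup>2 / (2 * s\<^sup>2)))"
proof -
  interpret prob_space Q by fact
  define u where "u = infdist l {lo..hi} - e"
  show ?thesis
  proof (cases "u \<le> 0")
    \<comment> \<open>The positive part vanishes, so the claimed bound is 1.\<close>
    case True
    then show ?thesis by (simp add: u_def max_absorb1)
  next
    case False
    have d: "infdist l {lo..hi} \<le> \<bar>l - b\<bar>" if "b \<in> {lo..hi}" for b
      using infdist_le[OF that, of l] by (simp add: dist_real_def)
    have dmu: "infdist l {lo..hi} \<le> \<bar>l - mu\<bar>" by (rule d[OF mu])
    have "measure Q {w \<in> space Q. \<bar>Z w - l\<bar> \<le> e} \<le> exp (- (u\<^sup>2 / (2 * s\<^sup>2)))"
    proof (cases "mu \<le> l")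
      case True
      \<comment> \<open>On the tube, \<open>Z w - mu\<close> is at least
        \<open>(l - e) - mu\<close>, that is \<open>\<bar>l - mu\<bar> - e\<close>, which is at
        least \<open>u\<close>.\<close>
      have "measure Q {w \<in> space Q. \<bar>Z w - l\<bar> \<le> e} \<le> measure Q {w \<in> space Q. Z w - mu \<ge> u}"
        using True dmu Z by (intro finite_measure_mono) (auto simp: u_def)
      also have "\<dots> \<le> exp (- (u\<^sup>2 / (2 * s\<^sup>2)))" using False by (intro up) simp
      finally show ?thesis .
    next
      case le: False
      have "measure Q {w \<in> space Q. \<bar>Z w - l\<bar> \<le> e} \<le> measure Q {w \<in> space Q. mu - Z w \<ge> u}"
        using le dmu Z by (intro finite_measure_mono) (auto simp: u_def)
      also have "\<dots> \<le> exp (- (u\<^sup>2 / (2 * s\<^sup>2)))" using False by (intro down) simp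
      finally show ?thesis .
    qed
    then show ?thesis using False by (simp add: u_def max_absorb2)
  qed
qed

text \<open>With \<open>r\<close> the smallest exponent, the union bound costs a factor
  \<open>n\<close>, which moves into the exponent as \<open>ln n\<close>. The trivial bound 1 on a
  probability supplies the positive part.\<close>

lemma measure_UN_exp_bound:
  assumes Q: "prob_space Q" and n: "1 \<le> n"
    and S: "\<And>m. m \<in> {1..n} \<Longrightarrow> S m \<in> sets Q"
    and bound: "\<And>m. m \<in> {1..n} \<Longrightarrow> measure Q (S m) \<le> exp (- a m)"
  shows "measure Q (\<Union>m\<in>{1..n}. S m) \<le> exp (- max 0 (Min (a ` {1..n}) - ln (real n)))"
proof -
  interpret prob_space Q by fact
  define r where "r = Min (a ` {1..n})"
  have "measure Q (\<Union>m\<in>{1..n}. S m) \<le> (\<Sum>m=1..n. measure Q (S m))"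
    using S by (intro finite_measure_subadditive_finite) auto
  also have "\<dots> \<le> (\<Sum>m=1..n. exp (- r))"
  proof (rule sum_mono)
    fix m assume m: "m \<in> {1..n}"
    have "r \<le> a m" unfolding r_def using m by (intro Min_le) auto
    then show "measure Q (S m) \<le> exp (- r)" using bound[OF m] by (smt (verit) exp_le_cancel_iff)
  qed
  also have "\<dots> = exp (- (r - ln (real n)))" using n by (simp add: exp_diff exp_minus field_simps)
  finally show ?thesis using prob_le_1 by (auto simp: r_def max_def)
qed

section \<open>Integrating conditional bounds over the law of the prefix\<close>

text \<open>The disintegration writes the left side as an integral of
  \<open>emeasure (kappa k) A\<close> over \<open>C\<close>, where the integrand is almost
  everywhere at most \<open>c\<close>. With \<open>A\<close> the event \<open>B t\<close> and
  \<open>Blt t\<close> as the preimage of \<open>C\<close>, this is the one-stage ratio.\<close>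

lemma regular_conditional_probability_bound:
  assumes P: "prob_space P" and rcp: "regular_conditional_probability P S Y kappa"
    and Y: "Y \<in> P \<rightarrow>\<^sub>M S" and A: "A \<in> sets P" and C: "C \<in> sets S" and c: "0 \<le> c"
    and bound: "AE w in P. Y w \<in> C \<longrightarrow> measure (kappa (Y w)) A \<le> c"
  shows "measure P (A \<inter> (Y -` C \<inter> space P)) \<le> c * measure P (Y -` C \<inter> space P)"
proof -
  interpret prob_space P by fact
  have kappa: "kappa \<in> S \<rightarrow>\<^sub>M prob_algebra P" using rcp by (simp add: regular_conditional_probability_def)
  have [measurable]: "(\<lambda>k. emeasure (kappa k) A) \<in> borel_measurable S"
    using measurable_prob_algebraD[OF kappa] measurable_emeasure_kernel A by blast
  note [measurable] = Y C A
  \<comment> \<open>Measurability of the preimage allows its indicator to be integrated to its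
    probability at the end.\<close>
  have YC: "Y -` C \<inter> space P \<in> sets P" by measurable
  have kp: "prob_space (kappa (Y w))" if "w \<in> space P" for w
    using measurable_space[OF kappa measurable_space[OF Y that]] by (simp add: space_prob_algebra)
  have "emeasure P (A \<inter> (Y -` C \<inter> space P)) = (\<integral>\<^sup>+k\<in>C. emeasure (kappa k) A \<partial>distr P S Y)"
    using rcp A C by (simp add: regular_conditional_probability_def)
  \<comment> \<open>The integral is pulled back to the sample space because \<open>bound\<close> is
    an almost-everywhere statement over \<open>P\<close>, not over the law of
    \<open>Y\<close>.\<close>
  also have "\<dots> = (\<integral>\<^sup>+w. emeasure (kappa (Y w)) A * indicator C (Y w) \<partial>P)"
    by (subst nn_integral_distr) auto
  also have "\<dots> \<le> (\<integral>\<^sup>+w. ennreal c * indicator (Y -` C \<inter> space P) w \<partial>P)"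
  proof (rule nn_integral_mono_AE)
    show "AE w in P. emeasure (kappa (Y w)) A * indicator C (Y w)
        \<le> ennreal c * indicator (Y -` C \<inter> space P) w"
      using bound
    proof (rule AE_mp, intro AE_I2 impI)
      fix w assume w: "w \<in> space P" and b: "Y w \<in> C \<longrightarrow> measure (kappa (Y w)) A \<le> c"
      interpret k: prob_space "kappa (Y w)" by (rule kp[OF w])
      show "emeasure (kappa (Y w)) A * indicator C (Y w)
          \<le> ennreal c * indicator (Y -` C \<inter> space P) w"
        using w b by (auto simp: k.emeasure_eq_measure ennreal_leI split: split_indicator)
    qed
  qed
  also have "\<dots> = ennreal (c * measure P (Y -` C \<inter> space P))"
    using c YC by (simp add: nn_integral_cmult_indicator emeasure_eq_measure ennreal_mult)
  finally show ?thesis using c by (simp add: emeasure_eq_measure)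
qed

section \<open>Negative logarithms in the extended reals\<close>

text \<open>Taking logarithms turns the ratio bound into \<open>g \<le> ln q - ln p\<close>. Testing
  only real \<open>g\<close> below \<open>G\<close> lets \<open>G\<close> be infinite, as happens
  when the support is empty, without evaluating an exponential at infinity.\<close>

lemma neg_log_ratio_ge:
  assumes "0 \<le> p" "p \<le> q"
    and ratio: "\<And>g. ereal g \<le> G \<Longrightarrow> p \<le> exp (- g) * q"
  shows "G + neg_log q \<le> neg_log p"
proof (cases "p = 0")
  case True
  then show ?thesis by (simp add: neg_log_def)
next
  case False
  then have pq: "0 < p" "0 < q" using assms by auto
  have bound: "g \<le> ln q - ln p" if "ereal g \<le> G" for g
  proof -
    have "ln p \<le> ln (exp (- g) * q)" using ratio[OF that] pq by (intro ln_mono) auto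
    also have "\<dots> = - g + ln q" using pq by (simp add: ln_mult)
    finally show ?thesis by simp
  qed
  have "G \<le> ereal (ln q - ln p)"
  proof (cases G)
    case PInf
    \<comment> \<open>An infinite \<open>G\<close> admits every real \<open>g\<close>. Choosing one
      that exceeds \<open>ln q - ln p\<close> by 1 contradicts \<open>bound\<close>, so this case is
      impossible for positive \<open>p\<close>.\<close>
    then have "ln q - ln p + 1 \<le> ln q - ln p"
      using bound[of "ln q - ln p + 1"] by simp
    then show ?thesis by simp
  qed (use bound in auto)
  then have "G + ereal (- ln q) \<le> ereal (ln q - ln p) + ereal (- ln q)" by (rule add_right_mono)
  then show ?thesis using pq by (simp add: neg_log_def)
qed

text \<open>Passes from the logarithmic to the exponential form. The value
  \<open>S = \<infinity>\<close> forces \<open>p = 0\<close>, matching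
  \<open>exp_ereal (-\<infinity>) = 0\<close>; for \<open>S = -\<infinity>\<close> the right side is
  infinite.\<close>

lemma le_exp_ereal_of_le_neg_log:
  assumes "0 \<le> p" "S \<le> neg_log p"
  shows "ereal p \<le> exp_ereal (- S)"
proof (cases "p = 0")
  case True
  then show ?thesis by (cases S) (auto simp: exp_ereal_def)
next
  case False
  then have "S \<le> ereal (- ln p)" using assms by (simp add: neg_log_def)
  then show ?thesis
  proof (cases S)
    case (real r)
    then have "ln p \<le> - r" using \<open>S \<le> ereal (- ln p)\<close> by simp
    then have "p \<le> exp (- r)" using False assms(1) by (metis exp_le_cancel_iff exp_ln less_eq_real_def)
    then show ?thesis using real by (simp add: exp_ereal_def)
  qed (auto simp: exp_ereal_def)
qed

section \<open>One-stage contraction and telescoping over the stages\<close>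

theorem theorem4:
  fixes P :: "'w measure"
    and X :: "('x, 'g, 's, 'a) stage_prefix topology"
    and h :: "'x \<Rightarrow> 'g list" and x :: 'x
    and tau :: "nat \<Rightarrow> 'w \<Rightarrow> ('s, 'a) trajectory"
    and answer :: "('g, 's, 'a) execution \<Rightarrow> 'y" and ystar :: "'x \<Rightarrow> 'y"
    and kappa :: "nat \<Rightarrow> ('x, 'g, 's, 'a) stage_prefix \<Rightarrow> 'w measure"
    and phi :: "'x \<Rightarrow> 'g + ('x, 'g, 's, 'a) stage_prefix \<Rightarrow> real"
    and M :: "nat \<Rightarrow> nat"
    and Z :: "nat \<Rightarrow> nat \<Rightarrow> 'w \<Rightarrow> real"
    and eps eta :: "nat \<Rightarrow> ('x, 'g, 's, 'a) stage_prefix \<Rightarrow> real"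
    and mulo muhi mu sigma :: "nat \<Rightarrow> nat \<Rightarrow> ('x, 'g, 's, 'a) stage_prefix \<Rightarrow> real"
    and T :: nat
    and K :: "nat \<Rightarrow> 'w \<Rightarrow> ('x, 'g, 's, 'a) stage_prefix"
    and Succ :: "'w set"
    and B Blt :: "nat \<Rightarrow> 'w set"
    and ell :: "nat \<Rightarrow> ('x, 'g, 's, 'a) stage_prefix \<Rightarrow> real"
    and tube :: "nat \<Rightarrow> ('x, 'g, 's, 'a) stage_prefix \<Rightarrow> 'w set"
    and a :: "nat \<Rightarrow> nat \<Rightarrow> ('x, 'g, 's, 'a) stage_prefix \<Rightarrow> real"
    and rho :: "nat \<Rightarrow> ('x, 'g, 's, 'a) stage_prefix \<Rightarrow> real"
    and R :: "nat \<Rightarrow> ('x, 'g, 's, 'a) stage_prefix set"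
    and gamma :: "nat \<Rightarrow> ereal"
  defines "T \<equiv> num_stages h x"
    and "K \<equiv> completed_prefix h x tau"
    and "Succ \<equiv> {w \<in> space P. answer (stages_upto h x tau T w) = ystar x}"
    and "B \<equiv> \<lambda>t. {w \<in> space P. recoverable h answer ystar (K t w)}"
    and "Blt \<equiv> \<lambda>t. {w \<in> space P. \<forall>s\<in>{1..<t}. w \<in> B s}"
    and "ell \<equiv> \<lambda>t k. phi x (Inl (sub_goal h x t)) - phi x (Inr k)"
    and "tube \<equiv> \<lambda>t k. \<Union>m\<in>{1..M t}. {w \<in> space P. \<bar>Z t m w - ell t k\<bar> \<le> eps t k}"
    and "a \<equiv> \<lambda>t m k. (max 0 (infdist (ell t k) {mulo t m k..muhi t m k} - eps t k))\<^sup>2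
                       / (2 * (sigma t m k)\<^sup>2)"
    and "rho \<equiv> \<lambda>t k. Min ((\<lambda>m. a t m k) ` {1..M t})"
    and "R \<equiv> \<lambda>t. conditional_support X P (Blt t) (K (t - 1))"
    and "gamma \<equiv> \<lambda>t. INF k\<in>R t. ereal (eta t k + max 0 (rho t k - ln (real (M t))))"
  assumes prob: "prob_space P"
    and polish: "Polish_topology X"
    and K_meas: "\<And>t. t \<le> T \<Longrightarrow> K t \<in> P \<rightarrow>\<^sub>M borel_of_topology X"
    and B_meas: "\<And>t. t \<in> {1..T} \<Longrightarrow> B t \<in> sets P"
    and Blt_meas: "\<And>t. t \<in> {1..T} \<Longrightarrow>
          Blt t \<in> sets (vimage_algebra (space P) (K (t - 1)) (borel_of_topology X))"
    and phi_meas: "(\<lambda>k. phi x (Inr k)) \<in> borel_measurable (borel_of_topology X)"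
    and Z_meas: "\<And>t m. t \<in> {1..T} \<Longrightarrow> m \<in> {1..M t} \<Longrightarrow> Z t m \<in> borel_measurable P"
    and eps_eta_meas: "\<And>t. t \<in> {1..T} \<Longrightarrow>
          eps t \<in> borel_measurable (borel_of_topology X) \<and>
          eta t \<in> borel_measurable (borel_of_topology X)"
    and mu_sigma_meas: "\<And>t m. t \<in> {1..T} \<Longrightarrow> m \<in> {1..M t} \<Longrightarrow>
          mulo t m \<in> borel_measurable (borel_of_topology X) \<and>
          muhi t m \<in> borel_measurable (borel_of_topology X) \<and>
          mu t m \<in> borel_measurable (borel_of_topology X) \<and>
          sigma t m \<in> borel_measurable (borel_of_topology X)"
    and kappa: "\<And>t. t < T \<Longrightarrow>
          regular_conditional_probability P (borel_of_topology X) (K t) (kappa t)"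
    and goal_consistency: "Succ = {w \<in> space P. \<forall>t\<in>{1..T}. w \<in> B t}"
    and M_ge_1: "\<And>t. t \<in> {1..T} \<Longrightarrow> 1 \<le> M t"
    and recoverability_tube: "\<And>t. t \<in> {1..T} \<Longrightarrow>
          AE w in P. w \<in> Blt t \<longrightarrow>
            0 \<le> eps t (K (t - 1) w) \<and>
            B t \<inter> {w' \<in> space P. K (t - 1) w' = K (t - 1) w} \<subseteq> tube t (K (t - 1) w)"
    and controllability_windows: "\<And>t. t \<in> {1..T} \<Longrightarrow>
          AE w in P. w \<in> Blt t \<longrightarrow>
            (\<forall>m\<in>{1..M t}. let k = K (t - 1) w in
               mulo t m k \<le> muhi t m k \<and> 0 < sigma t m k \<and> mu t m k \<in> {mulo t m k..muhi t m k} \<and>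
               (\<forall>u\<ge>0.
                 measure (kappa (t - 1) k) {w' \<in> space P. Z t m w' - mu t m k \<ge> u}
                   \<le> exp (- (u\<^sup>2 / (2 * (sigma t m k)\<^sup>2))) \<and>
                 measure (kappa (t - 1) k) {w' \<in> space P. mu t m k - Z t m w' \<ge> u}
                   \<le> exp (- (u\<^sup>2 / (2 * (sigma t m k)\<^sup>2)))))"
    and boundary_loss: "\<And>t. t \<in> {1..T} \<Longrightarrow>
          AE w in P. w \<in> Blt t \<longrightarrow>
            (let k = K (t - 1) w in
               0 \<le> eta t k \<and>
               measure (kappa (t - 1) k) (B t) \<le> exp (- eta t k) * measure (kappa (t - 1) k) (tube t k))"
  shows "(\<Sum>t=1..T. gamma t) \<le> neg_log (measure P Succ)
       \<and> ereal (measure P Succ) \<le> exp_ereal (- (\<Sum>t=1..T. gamma t))"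
proof -
  interpret prob_space P by fact
  let ?S = "borel_of_topology X"
  have X: "second_countable X" using polish by (simp add: Polish_topology_def)
  have Blt_Suc: "Blt (Suc t) = B t \<inter> Blt t" if "t \<in> {1..T}" for t
    using that by (auto simp: Blt_def B_def less_Suc_eq)
  \<comment> \<open>Stated for real \<open>g\<close> below \<open>gamma t\<close>, in the form
    required by \<open>neg_log_ratio_ge\<close>, since \<open>gamma t\<close> is infinite when
    \<open>Blt t\<close> is null.\<close>
  have stage: "measure P (Blt (Suc t)) \<le> exp (- g) * measure P (Blt t)"
    if t: "t \<in> {1..T}" and g: "ereal g \<le> gamma t" for t g
  proof -
    have K: "K (t - 1) \<in> P \<rightarrow>\<^sub>M ?S" using t by (intro K_meas) auto
    have rcp: "regular_conditional_probability P ?S (K (t - 1)) (kappa (t - 1))"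
      using t by (intro kappa) auto
    then have kap: "kappa (t - 1) \<in> ?S \<rightarrow>\<^sub>M prob_algebra P"
      by (simp add: regular_conditional_probability_def)
    \<comment> \<open>As \<open>Blt t\<close> is determined by the prefix, it is the preimage of a
      Borel set \<open>C\<close>; the conditional bound is integrated exactly over this set.\<close>
    obtain C where C: "C \<in> sets ?S" "Blt t = K (t - 1) -` C \<inter> space P"
      using Blt_meas[OF t] measurable_space[OF K] by (auto simp: sets_vimage_algebra2)
    have Blt_sets: "Blt t \<in> sets P" unfolding C(2) by (rule measurable_sets[OF K C(1)])
    have supp: "AE w in P. w \<in> Blt t \<longrightarrow> K (t - 1) w \<in> R t"
      unfolding R_def by (rule AE_conditional_support[OF prob X K Blt_sets])
    have "AE w in P. w \<in> Blt t \<longrightarrow> measure (kappa (t - 1) (K (t - 1) w)) (B t) \<le> exp (- g)"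
      using supp controllability_windows[OF t] boundary_loss[OF t]
    proof eventually_elim
      case (elim w)
      show ?case
      proof
        assume w: "w \<in> Blt t"
        let ?k = "K (t - 1) w"
        let ?Q = "kappa (t - 1) ?k"
        have "w \<in> space P" using w by (simp add: Blt_def)
        then have Q: "prob_space ?Q" "sets ?Q = sets P"
          using measurable_space[OF kap measurable_space[OF K]] by (auto simp: space_prob_algebra)
        \<comment> \<open>The hypotheses describe events within \<open>space P\<close>, while the
          tail lemma uses the space of the conditional law.\<close>
        have sp: "space ?Q = space P" by (rule sets_eq_imp_space_eq[OF Q(2)])
        have Z: "Z t m \<in> borel_measurable ?Q" if "m \<in> {1..M t}" for m
          using Z_meas[OF t that] Q(2) by (simp cong: measurable_cong_sets)
        have tube: "measure ?Q (tube t ?k) \<le> exp (- max 0 (rho t ?k - ln (real (M t))))"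
          unfolding tube_def rho_def
        proof (rule measure_UN_exp_bound[OF Q(1) M_ge_1[OF t]])
          fix m assume m: "m \<in> {1..M t}"
          note [measurable] = Z[OF m]
          have "{w \<in> space ?Q. \<bar>Z t m w - ell t ?k\<bar> \<le> eps t ?k} \<in> sets ?Q" by measurable
          then show "{w \<in> space P. \<bar>Z t m w - ell t ?k\<bar> \<le> eps t ?k} \<in> sets ?Q" unfolding sp .
          have win: "mu t m ?k \<in> {mulo t m ?k..muhi t m ?k}"
            "\<And>u. u \<ge> 0 \<Longrightarrow> measure ?Q {w' \<in> space ?Q. Z t m w' - mu t m ?k \<ge> u}
                   \<le> exp (- (u\<^sup>2 / (2 * (sigma t m ?k)\<^sup>2)))"
            "\<And>u. u \<ge> 0 \<Longrightarrow> measure ?Q {w' \<in> space ?Q. mu t m ?k - Z t m w' \<ge> u}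
                   \<le> exp (- (u\<^sup>2 / (2 * (sigma t m ?k)\<^sup>2)))"
            using elim(2) w m unfolding Let_def sp by blast+
          show "measure ?Q {w \<in> space P. \<bar>Z t m w - ell t ?k\<bar> \<le> eps t ?k} \<le> exp (- a t m ?k)"
            using tube_tail_bound[OF Q(1) Z[OF m] win] unfolding a_def sp .
        qed
        \<comment> \<open>Membership of the current prefix in \<open>R t\<close>, known almost
          surely on \<open>Blt t\<close>, makes the infimum a lower bound here.\<close>
        have "gamma t \<le> ereal (eta t ?k + max 0 (rho t ?k - ln (real (M t))))"
          unfolding gamma_def using elim(1) w by (intro INF_lower) auto
        then have "ereal g \<le> ereal (eta t ?k + max 0 (rho t ?k - ln (real (M t))))"
          by (rule order_trans[OF g])
        then have g': "g \<le> eta t ?k + max 0 (rho t ?k - ln (real (M t)))" by simp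
        have "measure ?Q (B t) \<le> exp (- eta t ?k) * measure ?Q (tube t ?k)"
          using elim(3) w by (simp add: Let_def)
        also have "\<dots> \<le> exp (- eta t ?k) * exp (- max 0 (rho t ?k - ln (real (M t))))"
          by (rule mult_left_mono[OF tube]) simp
        also have "\<dots> = exp (- (eta t ?k + max 0 (rho t ?k - ln (real (M t)))))"
          by (simp add: exp_add[symmetric])
        also have "\<dots> \<le> exp (- g)" using g' by simp
        finally show "measure ?Q (B t) \<le> exp (- g)" .
      qed
    qed
    then have "AE w in P. K (t - 1) w \<in> C \<longrightarrow> measure (kappa (t - 1) (K (t - 1) w)) (B t) \<le> exp (- g)"
      by (rule AE_mp) (auto simp: C(2))
    from regular_conditional_probability_bound[OF prob rcp K B_meas[OF t] C(1) _ this]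
    show ?thesis by (simp add: Blt_Suc[OF t] C(2))
  qed
  \<comment> \<open>The index is shifted by one: \<open>Blt (Suc n)\<close> requires recoverability
    through stage \<open>n\<close>. For \<open>n = 0\<close> it is the whole space, with negative
    logarithm 0.\<close>
  have telescope: "n \<le> T \<Longrightarrow> (\<Sum>t=1..n. gamma t) \<le> neg_log (measure P (Blt (Suc n)))" for n
  proof (induction n)
    case 0
    have "Blt (Suc 0) = space P" by (simp add: Blt_def)
    then show ?case by (simp add: neg_log_def prob_space)
  next
    case (Suc n)
    have n: "Suc n \<in> {1..T}" using Suc.prems by simp
    have "Blt (Suc n) \<in> sets P"
      using measurable_sets[OF K_meas] Blt_meas[OF n] n measurable_space[OF K_meas]
      by (auto simp: sets_vimage_algebra2)
    then have mono: "measure P (Blt (Suc (Suc n))) \<le> measure P (Blt (Suc n))"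
      unfolding Blt_Suc[OF n] by (intro finite_measure_mono) auto
    have "(\<Sum>t=1..Suc n. gamma t) = gamma (Suc n) + (\<Sum>t=1..n. gamma t)" by (simp add: add.commute)
    also have "\<dots> \<le> gamma (Suc n) + neg_log (measure P (Blt (Suc n)))"
      using Suc by (intro add_left_mono) simp
    also have "\<dots> \<le> neg_log (measure P (Blt (Suc (Suc n))))"
      using mono stage[OF n] by (intro neg_log_ratio_ge) auto
    finally show ?case .
  qed
  \<comment> \<open>Goal consistency identifies success with recoverability at all stages up to
    \<open>T\<close>, which is the endpoint of the telescoped bound.\<close>
  have "Succ = Blt (Suc T)"
    unfolding goal_consistency by (auto simp: Blt_def less_Suc_eq_le)
  then have "(\<Sum>t=1..T. gamma t) \<le> neg_log (measure P Succ)" using telescope[of T] by simp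
  then show ?thesis by (intro conjI le_exp_ereal_of_le_neg_log) auto
qed

end
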